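(* Let $K$ be a partition of $X$ parametrized by $(T,\mathcal A,\phi)$ and let $d,\rho\in\mathcal D_A(X,\mathcal O)$. Then the weight functions $g_d$ and $g_\rho$ are bi-Lipschitz equivalent (there are $c_1,c_2>0$ with $c_1g_d(w)\le g_\rho(w)\le c_2g_d(w)$ for all $w\in T$) if and only if $d$ and $\rho$ are bi-Lipschitz equivalent as metrics (there are $c_1,c_2>0$ with $c_1d(x,y)\le\rho(x,y)\le c_2d(x,y)$ for all $x,y\in X$). In particular, the correspondence sending the bi-Lipschitz class of $d$ to the bi-Lipschitz class of $g_d$ gives a well-defined injective map from $\mathcal D_A(X,\mathcal O)$ modulo bi-Lipschitz equivalence of metrics to $\mathcal G(T)$ modulo bi-Lipschitz equivalence of weight functions.
   Context: Setting. $T$ is a countably infinite set, $\mathcal A:T\times T\to\{0,1\}$ is symmetric and vanishes on the diagonal, the graph on $T$ with edges $\{(w,v):\mathcal A(w,v)=1\}$ is a locally finite tree, and $\phi\in T$ is a fixed root. For $w\in T$: $|w|$ is the tree distance from $\phi$ to $w$; $(T)_m=\{w:|w|=m\}$; $\pi(w)$ is the neighbour of $w$ on the geodesic from $\phi$ to $w$ ($\pi(\phi)=\phi$); $S(w)$ is the set of neighbours of $w$ other than $\pi(w)$. $\Sigma$ is the set of infinite geodesic rays $\omega=([\omega]_0=\phi,[\omega]_1,\ldots)$ of the tree starting at $\phi$. $(X,\mathcal O)$ is a compact metrizable topological space with no isolated point. A partition $K$ of $X$ parametrized by $(T,\mathcal A,\phi)$ assigns to each $w\in T$ a nonempty compact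 set $K_w\subseteq X$ such that $K_\phi=X$, $K_w=\bigcup_{v\in S(w)}K_v$ for all $w$, and $\bigcap_{m\ge0}K_{[\omega]_m}$ is a single point for every $\omega\in\Sigma$. Weight functions. A weight function is $g:T\to(0,1]$ with $g(\phi)=1$, $g(\pi(w))\ge g(w)$ for all $w$, and $\lim_{m\to\infty}\sup_{w\in(T)_m}g(w)=0$; $\mathcal G(T)$ is the set of weight functions. For $s\in(0,1)$, $\Lambda^g_s=\{w\in T: g(\pi(w))>s\ge g(w)\}$; for $s\ge1$, $\Lambda^g_s=\{\phi\}$. For an integer $M\ge0$, $x\in X$, $s>0$, $U^g_M(x,s)$ is the set of $y\in X$ for which there are $w(1),\ldots,w(M+1)\in\Lambda^g_s$ with $x\in K_{w(1)}$, $y\in K_{w(M+1)}$ and $K_{w(i)}\cap K_{w(i+1)}\ne\emptyset$ for $1\le i\le M$. Metrics. $\mathcal D(X,\mathcal O)$ is the set of metrics $d$ on $X$ inducing $\mathcal O$ with $\operatorname{diam}(X,d)=1$; $B_d(x,r)=\{y:d(x,y)<r\}$. For $d\in\mathcal D(X,\mathcal O)$, $g_d:T\to(0,1]$, $g_d(w)=\operatorname{diam}(K_w,d)$. $d$ is $M$-adapted to a weight function $g$ if there are $\alpha_1,\alpha_2>0$ with $U^g_M(x,\alpha_1r)\subseteq B_d(x,r)\subseteq U^g_M(x,\alpha_2r)$ for all $x\in X$, $r>0$; $d$ is adapted to $g$ if it is $M$-adapted to $g$ for some integer $M\ge0$. $d$ is called adapted if $g_d$ is a weight function (i.e. all $\operatorname{diam}(K_w,d)>0$)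 and $d$ is adapted to $g_d$. $\mathcal D_A(X,\mathcal O)$ is the set of adapted $d\in\mathcal D(X,\mathcal O)$. *)

theory Defs
  imports "HOL-Analysis.Analysis"
begin

(* The vertex set T is the type 'v and the space X is the type 'x, whose topology is
   the one of the class topological_space. Metrics on X are functions d with
   "Metric_space UNIV d"; they have nothing to do with the type class metric_space. *)

section \<open>Rooted trees\<close>

definition simple_path :: "('v \<Rightarrow> 'v \<Rightarrow> nat) \<Rightarrow> 'v \<Rightarrow> 'v \<Rightarrow> 'v list \<Rightarrow> bool" where
  "simple_path A w v p \<longleftrightarrow>
     p \<noteq> [] \<and> hd p = w \<and> last p = v \<and> successively (\<lambda>a b. A a b = 1) p \<and> distinct p"

definition is_tree :: "('v \<Rightarrow> 'v \<Rightarrow> nat) \<Rightarrow> bool" where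
  "is_tree A \<longleftrightarrow> (\<forall>w v. \<exists>!p. simple_path A w v p)"

definition locally_finite_tree :: "('v \<Rightarrow> 'v \<Rightarrow> nat) \<Rightarrow> bool" where
  "locally_finite_tree A \<longleftrightarrow>
     (\<forall>w v. A w v \<in> {0, 1}) \<and> (\<forall>w v. A w v = A v w) \<and> (\<forall>w. A w w = 0) \<and>
     is_tree A \<and> (\<forall>w. finite {v. A w v = 1})"

definition geodesic :: "('v \<Rightarrow> 'v \<Rightarrow> nat) \<Rightarrow> 'v \<Rightarrow> 'v \<Rightarrow> 'v list" where
  "geodesic A w v = (THE p. simple_path A w v p)"

(* |w|: the number of edges of the geodesic from the root to w *)
definition height :: "('v \<Rightarrow> 'v \<Rightarrow> nat) \<Rightarrow> 'v \<Rightarrow> 'v \<Rightarrow> nat" where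
  "height A \<phi> w = length (geodesic A \<phi> w) - 1"

definition level :: "('v \<Rightarrow> 'v \<Rightarrow> nat) \<Rightarrow> 'v \<Rightarrow> nat \<Rightarrow> 'v set" where
  "level A \<phi> m = {w. height A \<phi> w = m}"

definition parent :: "('v \<Rightarrow> 'v \<Rightarrow> nat) \<Rightarrow> 'v \<Rightarrow> 'v \<Rightarrow> 'v" where
  "parent A \<phi> w =
     (if w = \<phi> then \<phi> else (THE u. A w u = 1 \<and> u \<in> set (geodesic A \<phi> w)))"

definition children :: "('v \<Rightarrow> 'v \<Rightarrow> nat) \<Rightarrow> 'v \<Rightarrow> 'v \<Rightarrow> 'v set" where
  "children A \<phi> w = {v. A w v = 1} - {parent A \<phi> w}"

definition rays :: "('v \<Rightarrow> 'v \<Rightarrow> nat) \<Rightarrow> 'v \<Rightarrow> (nat \<Rightarrow> 'v) set" where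
  "rays A \<phi> =
     {\<omega>. \<omega> 0 = \<phi> \<and> (\<forall>m. geodesic A \<phi> (\<omega> m) = map \<omega> [0..<Suc m])}"

section \<open>Partitions and weight functions\<close>

definition partition_of_space ::
  "('v \<Rightarrow> 'v \<Rightarrow> nat) \<Rightarrow> 'v \<Rightarrow> ('v \<Rightarrow> 'x::topological_space set) \<Rightarrow> bool" where
  "partition_of_space A \<phi> K \<longleftrightarrow>
     (\<forall>w. K w \<noteq> {} \<and> compact (K w)) \<and>
     K \<phi> = UNIV \<and>
     (\<forall>w. K w = (\<Union>v\<in>children A \<phi> w. K v)) \<and>
     (\<forall>\<omega>\<in>rays A \<phi>. \<exists>x. (\<Inter>m. K (\<omega> m)) = {x})"

definition weight_functions :: "('v \<Rightarrow> 'v \<Rightarrow> nat) \<Rightarrow> 'v \<Rightarrow> ('v \<Rightarrow> real) set" where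
  "weight_functions A \<phi> =
     {g. (\<forall>w. 0 < g w \<and> g w \<le> 1) \<and> g \<phi> = 1 \<and> (\<forall>w. g (parent A \<phi> w) \<ge> g w) \<and>
         (\<lambda>m. SUP w\<in>level A \<phi> m. g w) \<longlonglongrightarrow> 0}"

(* only used for s > 0 *)
definition scale :: "('v \<Rightarrow> 'v \<Rightarrow> nat) \<Rightarrow> 'v \<Rightarrow> ('v \<Rightarrow> real) \<Rightarrow> real \<Rightarrow> 'v set" where
  "scale A \<phi> g s = (if s \<ge> 1 then {\<phi>} else {w. g (parent A \<phi> w) > s \<and> s \<ge> g w})"

(* U^g_M(x,s) *)
definition chain_nbhd ::
  "('v \<Rightarrow> 'v \<Rightarrow> nat) \<Rightarrow> 'v \<Rightarrow> ('v \<Rightarrow> 'x set) \<Rightarrow> ('v \<Rightarrow> real) \<Rightarrow> nat \<Rightarrow> 'x \<Rightarrow> real \<Rightarrow> 'x set" where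
  "chain_nbhd A \<phi> K g M x s =
     {y. \<exists>w :: nat \<Rightarrow> 'v. (\<forall>i\<in>{1..M+1}. w i \<in> scale A \<phi> g s) \<and>
           x \<in> K (w 1) \<and> y \<in> K (w (M+1)) \<and>
           (\<forall>i\<in>{1..M}. K (w i) \<inter> K (w (i+1)) \<noteq> {})}"

section \<open>Metrics\<close>

(* for a metric and nonempty bounded S; the constant diameter of HOL-Analysis refers to
   the metric of the type class *)
definition diam :: "('x \<Rightarrow> 'x \<Rightarrow> real) \<Rightarrow> 'x set \<Rightarrow> real" where
  "diam d S = (SUP (x, y)\<in>S \<times> S. d x y)"

definition metrics :: "('x::topological_space \<Rightarrow> 'x \<Rightarrow> real) set" where
  "metrics =
     {d. Metric_space UNIV d \<and> Metric_space.mtopology UNIV d = euclidean \<and> diam d UNIV = 1}"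

definition metric_weight :: "('v \<Rightarrow> 'x set) \<Rightarrow> ('x \<Rightarrow> 'x \<Rightarrow> real) \<Rightarrow> 'v \<Rightarrow> real" where
  "metric_weight K d w = diam d (K w)"

definition M_adapted_to ::
  "('v \<Rightarrow> 'v \<Rightarrow> nat) \<Rightarrow> 'v \<Rightarrow> ('v \<Rightarrow> 'x set) \<Rightarrow> nat \<Rightarrow> ('x \<Rightarrow> 'x \<Rightarrow> real) \<Rightarrow> ('v \<Rightarrow> real) \<Rightarrow> bool" where
  "M_adapted_to A \<phi> K M d g \<longleftrightarrow>
     (\<exists>\<alpha>\<^sub>1>0. \<exists>\<alpha>\<^sub>2>0. \<forall>x. \<forall>r>0.
        chain_nbhd A \<phi> K g M x (\<alpha>\<^sub>1 * r) \<subseteq> Metric_space.mball UNIV d x r \<and>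
        Metric_space.mball UNIV d x r \<subseteq> chain_nbhd A \<phi> K g M x (\<alpha>\<^sub>2 * r))"

definition adapted_to ::
  "('v \<Rightarrow> 'v \<Rightarrow> nat) \<Rightarrow> 'v \<Rightarrow> ('v \<Rightarrow> 'x set) \<Rightarrow> ('x \<Rightarrow> 'x \<Rightarrow> real) \<Rightarrow> ('v \<Rightarrow> real) \<Rightarrow> bool" where
  "adapted_to A \<phi> K d g \<longleftrightarrow> (\<exists>M. M_adapted_to A \<phi> K M d g)"

definition adapted_metrics ::
  "('v \<Rightarrow> 'v \<Rightarrow> nat) \<Rightarrow> 'v \<Rightarrow> ('v \<Rightarrow> 'x::topological_space set) \<Rightarrow> ('x \<Rightarrow> 'x \<Rightarrow> real) set" where
  "adapted_metrics A \<phi> K =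
     {d \<in> metrics. metric_weight K d \<in> weight_functions A \<phi> \<and>
                   adapted_to A \<phi> K d (metric_weight K d)}"

section \<open>Bi-Lipschitz equivalence\<close>

definition bilipschitz_weights :: "('v \<Rightarrow> real) \<Rightarrow> ('v \<Rightarrow> real) \<Rightarrow> bool" where
  "bilipschitz_weights g h \<longleftrightarrow>
     (\<exists>c\<^sub>1>0. \<exists>c\<^sub>2>0. \<forall>w. c\<^sub>1 * g w \<le> h w \<and> h w \<le> c\<^sub>2 * g w)"

definition bilipschitz_metrics :: "('x \<Rightarrow> 'x \<Rightarrow> real) \<Rightarrow> ('x \<Rightarrow> 'x \<Rightarrow> real) \<Rightarrow> bool" where
  "bilipschitz_metrics d \<rho> \<longleftrightarrow>
     (\<exists>c\<^sub>1>0. \<exists>c\<^sub>2>0. \<forall>x y. c\<^sub>1 * d x y \<le> \<rho> x y \<and> \<rho> x y \<le> c\<^sub>2 * d x y)"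

definition weight_equiv :: "('v \<Rightarrow> 'v \<Rightarrow> nat) \<Rightarrow> 'v \<Rightarrow> (('v \<Rightarrow> real) \<times> ('v \<Rightarrow> real)) set" where
  "weight_equiv A \<phi> =
     {(g, h). g \<in> weight_functions A \<phi> \<and> h \<in> weight_functions A \<phi> \<and> bilipschitz_weights g h}"

definition adapted_metric_equiv ::
  "('v \<Rightarrow> 'v \<Rightarrow> nat) \<Rightarrow> 'v \<Rightarrow> ('v \<Rightarrow> 'x::topological_space set)
     \<Rightarrow> (('x \<Rightarrow> 'x \<Rightarrow> real) \<times> ('x \<Rightarrow> 'x \<Rightarrow> real)) set" where
  "adapted_metric_equiv A \<phi> K =
     {(d, \<rho>). d \<in> adapted_metrics A \<phi> K \<and> \<rho> \<in> adapted_metrics A \<phi> K \<and> bilipschitz_metrics d \<rho>}"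

lemma bilipschitz_weights_refl: "bilipschitz_weights g g"
  unfolding bilipschitz_weights_def by (rule exI[of _ 1], simp, rule exI[of _ 1], simp)

lemma bilipschitz_weights_sym:
  assumes "bilipschitz_weights g h"
  shows "bilipschitz_weights h g"
proof -
  obtain a b where ab: "a > 0" "b > 0" "\<And>w. a * g w \<le> h w \<and> h w \<le> b * g w"
    using assms unfolding bilipschitz_weights_def by blast
  then have "1 / b * h w \<le> g w \<and> g w \<le> 1 / a * h w" for w
    using ab(3)[of w] by (simp add: field_simps)
  then show ?thesis
    unfolding bilipschitz_weights_def using ab(1,2) by (meson zero_less_divide_1_iff)
qed

lemma bilipschitz_weights_trans:
  assumes "bilipschitz_weights g h" "bilipschitz_weights h k"
  shows "bilipschitz_weights g k"
proof -
  obtain a b where ab: "a > 0" "b > 0" "\<And>w. a * g w \<le> h w \<and> h w \<le> b * g w"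
    using assms(1) unfolding bilipschitz_weights_def by blast
  obtain c e where ce: "c > 0" "e > 0" "\<And>w. c * h w \<le> k w \<and> k w \<le> e * h w"
    using assms(2) unfolding bilipschitz_weights_def by blast
  have "(c * a) * g w \<le> k w \<and> k w \<le> (e * b) * g w" for w
  proof -
    have "c * (a * g w) \<le> c * h w" "e * h w \<le> e * (b * g w)"
      using ab(3)[of w] ce(1,2) by (auto intro: mult_left_mono)
    then show ?thesis using ce(3)[of w] by (simp add: mult.assoc)
  qed
  then show ?thesis
    unfolding bilipschitz_weights_def using ab(1,2) ce(1,2) by (meson mult_pos_pos)
qed

lemma bilipschitz_metrics_iff_uncurried:
  "bilipschitz_metrics d \<rho> \<longleftrightarrow> bilipschitz_weights (case_prod d) (case_prod \<rho>)"
  unfolding bilipschitz_metrics_def bilipschitz_weights_def by simp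

lemma equiv_weight_equiv: "equiv (weight_functions A \<phi>) (weight_equiv A \<phi>)"
  by (intro equivI refl_onI symI transI)
     (auto simp: weight_equiv_def
       intro: bilipschitz_weights_refl bilipschitz_weights_sym bilipschitz_weights_trans)

lemma equiv_adapted_metric_equiv:
  "equiv (adapted_metrics A \<phi> K) (adapted_metric_equiv A \<phi> K)"
  by (intro equivI refl_onI symI transI)
     (auto simp: adapted_metric_equiv_def bilipschitz_metrics_iff_uncurried
       intro: bilipschitz_weights_refl bilipschitz_weights_sym bilipschitz_weights_trans)

end

theory Submission
  imports Defs
begin

text \<open>Bi-Lipschitz metrics have comparable diameters on every set. Conversely, let d be adapted to
  its own weight. Two points at distance \<open>t > 0\<close> lie in \<open>B\<^sub>d(x, 2t)\<close>, hence are joined by a chain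
  of at most M + 1 cells whose d-diameters are bounded by a multiple of t. If the weights are
  bi-Lipschitz equivalent, the \<open>\<rho>\<close>-diameters of these cells are bounded by a multiple of t as well,
  and the triangle inequality along the chain bounds \<open>\<rho>(x, y)\<close>.\<close>

text \<open>\<open>diam\<close> is a supremum of reals, so it bounds distances only on bounded sets.
  Since \<open>d\<close> induces the given topology, compactness of the space carries over to
  \<open>mtopology\<close> and makes the whole space bounded.\<close>

lemma metrics_bdd_above:
  fixes d :: "'x::topological_space \<Rightarrow> 'x \<Rightarrow> real"
  assumes "compact (UNIV :: 'x set)" and "d \<in> metrics"
  shows "bdd_above ((\<lambda>(x, y). d x y) ` (S \<times> S))"
proof -
  interpret Metric_space UNIV d
    using assms(2) by (simp add: metrics_def)
  have "compactin mtopology UNIV"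
    using assms by (simp add: metrics_def)
  then have "mbounded UNIV"
    by (rule compactin_imp_mbounded)
  then obtain B where "\<And>x y. d x y \<le> B"
    unfolding mbounded_alt by auto
  then show ?thesis
    by (auto intro!: bdd_aboveI[of _ B])
qed

lemma dist_le_diam:
  fixes d :: "'x::topological_space \<Rightarrow> 'x \<Rightarrow> real"
  assumes "compact (UNIV :: 'x set)" and "d \<in> metrics" and "x \<in> S" and "y \<in> S"
  shows "d x y \<le> diam d S"
  unfolding diam_def using cSUP_upper[OF _ metrics_bdd_above[OF assms(1,2)], of "(x, y)" S] assms(3,4)
  by simp

lemma diam_le:
  assumes "S \<noteq> {}" and "\<And>x y. x \<in> S \<Longrightarrow> y \<in> S \<Longrightarrow> d x y \<le> B"
  shows "diam d S \<le> B"
  unfolding diam_def using assms by (intro cSUP_least) auto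

lemma diam_le_mult_diam:
  fixes d \<rho> :: "'x::topological_space \<Rightarrow> 'x \<Rightarrow> real"
  assumes "compact (UNIV :: 'x set)" and "d \<in> metrics" and "S \<noteq> {}" and "0 < c"
    and "\<And>x y. \<rho> x y \<le> c * d x y"
  shows "diam \<rho> S \<le> c * diam d S"
proof (rule diam_le[OF assms(3)])
  fix x y assume "x \<in> S" "y \<in> S"
  then have "c * d x y \<le> c * diam d S"
    using dist_le_diam[OF assms(1,2)] assms(4) by (intro mult_left_mono) auto
  then show "\<rho> x y \<le> c * diam d S"
    using assms(5)[of x y] by linarith
qed

text \<open>A lower bound with constant 1/c is an upper bound with constant c and the roles
  exchanged. This reduces the equivalence to two one-sided estimates, both obtained from one
  argument by swapping the metrics.\<close>

lemma bilipschitz_weights_iff_upper: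
  "bilipschitz_weights g h \<longleftrightarrow>
     (\<exists>c>0. \<forall>w. h w \<le> c * g w) \<and> (\<exists>c>0. \<forall>w. g w \<le> c * h w)"
proof
  assume "bilipschitz_weights g h"
  with bilipschitz_weights_sym[OF this]
  show "(\<exists>c>0. \<forall>w. h w \<le> c * g w) \<and> (\<exists>c>0. \<forall>w. g w \<le> c * h w)"
    unfolding bilipschitz_weights_def by blast
next
  assume "(\<exists>c>0. \<forall>w. h w \<le> c * g w) \<and> (\<exists>c>0. \<forall>w. g w \<le> c * h w)"
  then obtain b c where bc: "b > 0" "\<And>w. h w \<le> b * g w" "c > 0" "\<And>w. g w \<le> c * h w"
    by blast
  then have "1 / c * g w \<le> h w" for w
    by (simp add: field_simps)
  then show "bilipschitz_weights g h"
    unfolding bilipschitz_weights_def using bc by (meson zero_less_divide_1_iff)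
qed

lemma bilipschitz_metrics_iff_upper:
  "bilipschitz_metrics d \<rho> \<longleftrightarrow>
     (\<exists>c>0. \<forall>x y. \<rho> x y \<le> c * d x y) \<and> (\<exists>c>0. \<forall>x y. d x y \<le> c * \<rho> x y)"
  unfolding bilipschitz_metrics_iff_uncurried bilipschitz_weights_iff_upper by simp

text \<open>For s \<ge> 1 the only cell is the root, whose weight 1 is still at most s; for smaller
  s the bound is part of the definition of \<open>scale\<close>.\<close>

lemma scale_weight_le:
  assumes "g \<in> weight_functions A \<phi>" and "w \<in> scale A \<phi> g s"
  shows "g w \<le> s"
  using assms by (auto simp: scale_def weight_functions_def split: if_splits)

text \<open>Consecutive cells share a point, so by the triangle inequality each further cell adds at
  most \<open>b\<close>. The induction leaves \<open>y\<close> arbitrary, because the hypothesis is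
  applied to such a shared point.\<close>

lemma dist_le_chain:
  fixes \<rho> :: "'x::topological_space \<Rightarrow> 'x \<Rightarrow> real"
  assumes "compact (UNIV :: 'x set)" and "\<rho> \<in> metrics"
    and "x \<in> K (w 1)"
    and "\<And>i. i \<in> {1..M+1} \<Longrightarrow> diam \<rho> (K (w i)) \<le> b"
    and "\<And>i. i \<in> {1..M} \<Longrightarrow> K (w i) \<inter> K (w (i+1)) \<noteq> {}"
    and "y \<in> K (w (M+1))"
  shows "\<rho> x y \<le> real (M+1) * b"
  using assms(4-6)
proof (induction M arbitrary: y)
  case 0
  then show ?case
    using dist_le_diam[OF assms(1-3), of y] by force
next
  case (Suc M)
  interpret Metric_space UNIV \<rho>
    using assms(2) by (simp add: metrics_def)
  obtain z where z: "z \<in> K (w (M+1))" "z \<in> K (w (M+2))"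
    using Suc.prems(2)[of "M+1"] by auto
  have "\<rho> x z \<le> real (M+1) * b"
    using Suc.prems(1,2) z(1) by (intro Suc.IH) auto
  moreover have "\<rho> z y \<le> b"
    using dist_le_diam[OF assms(1,2) z(2), of y] Suc.prems(1)[of "M+2"] Suc.prems(3) by force
  moreover have "\<rho> x y \<le> \<rho> x z + \<rho> z y"
    by (rule triangle) auto
  ultimately show ?case
    by (simp add: algebra_simps)
qed

lemma metric_le_of_weight_le:
  fixes d \<rho> :: "'x::topological_space \<Rightarrow> 'x \<Rightarrow> real"
  assumes "compact (UNIV :: 'x set)"
    and d: "d \<in> adapted_metrics A \<phi> K" and \<rho>: "\<rho> \<in> metrics"
    and c: "c > 0" "\<And>w. metric_weight K \<rho> w \<le> c * metric_weight K d w"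
  shows "\<exists>c'>0. \<forall>x y. \<rho> x y \<le> c' * d x y"
proof -
  let ?g = "metric_weight K d"
  interpret d: Metric_space UNIV d
    using d by (simp add: adapted_metrics_def metrics_def)
  interpret \<rho>: Metric_space UNIV \<rho>
    using \<rho> by (simp add: metrics_def)
  have g: "?g \<in> weight_functions A \<phi>"
    using d by (simp add: adapted_metrics_def)
  obtain M \<alpha> where \<alpha>: "\<alpha> > 0"
    "\<And>x r. r > 0 \<Longrightarrow> d.mball x r \<subseteq> chain_nbhd A \<phi> K ?g M x (\<alpha> * r)"
    using d unfolding adapted_metrics_def adapted_to_def M_adapted_to_def by blast
  \<comment> \<open>There are M+1 cells, each of \<rho>-diameter at most
    \<open>c * (\<alpha> * r)\<close>, where the radius \<open>r\<close> will be twice the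
    distance.\<close>
  let ?c = "real (M+1) * (c * (\<alpha> * 2))"
  have "\<rho> x y \<le> ?c * d x y" for x y
  \<comment> \<open>Coinciding points are treated apart, since the ball inclusion requires a
    positive radius.\<close>
  proof (cases "x = y")
    case True
    then show ?thesis by simp
  next
    case False
    \<comment> \<open>Balls are open, so the radius must exceed the distance; the factor 2 achieves
      this and keeps \<open>r\<close> proportional to \<open>d x y\<close>.\<close>
    define r where "r = 2 * d x y"
    have "d x y > 0"
      using False by simp
    then have "r > 0" and "y \<in> d.mball x r"
      by (auto simp: r_def)
    then have "y \<in> chain_nbhd A \<phi> K ?g M x (\<alpha> * r)"
      using \<alpha>(2) by blast
    then obtain w where w: "\<And>i. i \<in> {1..M+1} \<Longrightarrow> w i \<in> scale A \<phi> ?g (\<alpha> * r)"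
        "x \<in> K (w 1)" "y \<in> K (w (M+1))"
        "\<And>i. i \<in> {1..M} \<Longrightarrow> K (w i) \<inter> K (w (i+1)) \<noteq> {}"
      unfolding chain_nbhd_def by blast
    have "diam \<rho> (K (w i)) \<le> c * (\<alpha> * r)" if "i \<in> {1..M+1}" for i
    proof -
      have "c * ?g (w i) \<le> c * (\<alpha> * r)"
        using scale_weight_le[OF g w(1)[OF that]] c(1) by (intro mult_left_mono) auto
      then show ?thesis
        using c(2)[of "w i"] by (simp add: metric_weight_def)
    qed
    then have "\<rho> x y \<le> real (M+1) * (c * (\<alpha> * r))"
      using dist_le_chain[OF assms(1) \<rho>, where K = K and w = w] w(2-4) by blast
    then show ?thesis
      by (simp add: r_def mult.assoc)
  qed
  moreover have "?c > 0"
    using c(1) \<alpha>(1) by simp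
  ultimately show ?thesis
    by blast
qed

lemma bilipschitz_metric_weight_iff:
  fixes K :: "'v \<Rightarrow> 'x::topological_space set"
  assumes "compact (UNIV :: 'x set)" and "\<And>w. K w \<noteq> {}"
    and d: "d \<in> adapted_metrics A \<phi> K" and \<rho>: "\<rho> \<in> adapted_metrics A \<phi> K"
  shows "bilipschitz_weights (metric_weight K d) (metric_weight K \<rho>) \<longleftrightarrow> bilipschitz_metrics d \<rho>"
proof -
  \<comment> \<open>Stated for a generic ordered pair, so that it serves once for (d, \<rho>) and
    once for (\<rho>, d).\<close>
  have le_iff: "(\<exists>c>0. \<forall>w. metric_weight K q w \<le> c * metric_weight K p w) \<longleftrightarrow>
        (\<exists>c>0. \<forall>x y. q x y \<le> c * p x y)"
    if p: "p \<in> adapted_metrics A \<phi> K" and q: "q \<in> adapted_metrics A \<phi> K" for p q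
  proof
    assume "\<exists>c>0. \<forall>w. metric_weight K q w \<le> c * metric_weight K p w"
    then obtain c where c: "c > 0" "\<And>w. metric_weight K q w \<le> c * metric_weight K p w"
      by blast
    have "q \<in> metrics"
      using q by (simp add: adapted_metrics_def)
    from metric_le_of_weight_le[OF assms(1) p this c]
    show "\<exists>c>0. \<forall>x y. q x y \<le> c * p x y" .
  next
    assume "\<exists>c>0. \<forall>x y. q x y \<le> c * p x y"
    then obtain c where c: "c > 0" "\<And>x y. q x y \<le> c * p x y"
      by blast
    have "p \<in> metrics"
      using p by (simp add: adapted_metrics_def)
    from diam_le_mult_diam[OF assms(1) this assms(2) c]
    have "metric_weight K q w \<le> c * metric_weight K p w" for w
      by (simp add: metric_weight_def)
    with \<open>c > 0\<close> show "\<exists>c>0. \<forall>w. metric_weight K q w \<le> c * metric_weight K p w"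
      by blast
  qed
  show ?thesis
    unfolding bilipschitz_weights_iff_upper bilipschitz_metrics_iff_upper
    using le_iff[OF d \<rho>] le_iff[OF \<rho> d] by simp
qed

theorem corollary8p10:
  fixes A :: "'v \<Rightarrow> 'v \<Rightarrow> nat" and \<phi> :: 'v
    and K :: "'v \<Rightarrow> 'x::topological_space set"
  assumes "infinite (UNIV :: 'v set)" and "countable (UNIV :: 'v set)"
    and "locally_finite_tree A"
    and "compact (UNIV :: 'x set)"
    and "metrizable_space (euclidean :: 'x topology)"
    and "\<forall>x::'x. \<not> open {x}"
    and "partition_of_space A \<phi> K"
  shows "(\<forall>d\<in>adapted_metrics A \<phi> K. \<forall>\<rho>\<in>adapted_metrics A \<phi> K.
            bilipschitz_weights (metric_weight K d) (metric_weight K \<rho>)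
              \<longleftrightarrow> bilipschitz_metrics d \<rho>)
       \<and> (\<exists>F \<in> (adapted_metrics A \<phi> K // adapted_metric_equiv A \<phi> K)
                  \<rightarrow> (weight_functions A \<phi> // weight_equiv A \<phi>).
            (\<forall>d\<in>adapted_metrics A \<phi> K.
               F (adapted_metric_equiv A \<phi> K `` {d}) = weight_equiv A \<phi> `` {metric_weight K d})
            \<and> inj_on F (adapted_metrics A \<phi> K // adapted_metric_equiv A \<phi> K))"
proof -
  let ?D = "adapted_metrics A \<phi> K" and ?R = "adapted_metric_equiv A \<phi> K"
  let ?W = "weight_functions A \<phi>" and ?E = "weight_equiv A \<phi>"
  let ?f = "\<lambda>d. ?E `` {metric_weight K d}"
  have ne: "K w \<noteq> {}" for w
    using assms(7) unfolding partition_of_space_def by blast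
  have iff: "bilipschitz_weights (metric_weight K d) (metric_weight K \<rho>)
      \<longleftrightarrow> bilipschitz_metrics d \<rho>" if "d \<in> ?D" "\<rho> \<in> ?D" for d \<rho>
    by (rule bilipschitz_metric_weight_iff[OF assms(4) ne that])
  have weight: "metric_weight K d \<in> ?W" if "d \<in> ?D" for d
    using that by (simp add: adapted_metrics_def)
  \<comment> \<open>Read from right to left this makes the map on classes well defined; read from
    left to right it makes it injective.\<close>
  have f_eq_iff: "?f d = ?f \<rho> \<longleftrightarrow> (d, \<rho>) \<in> ?R" if "d \<in> ?D" "\<rho> \<in> ?D" for d \<rho>
    using eq_equiv_class_iff[OF equiv_weight_equiv weight weight] iff weight that
    by (simp add: weight_equiv_def adapted_metric_equiv_def)
  have respects: "?f respects ?R"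
    by (rule congruentI) (use f_eq_iff in \<open>auto simp: adapted_metric_equiv_def\<close>)
  \<comment> \<open>All members of a class \<open>C\<close> have the same image under
    \<open>?f\<close>, so the union is that common image and no representative has to be
    chosen.\<close>
  define F where "F = (\<lambda>C. \<Union>d\<in>C. ?f d)"
  have F: "F (?R `` {d}) = ?f d" if "d \<in> ?D" for d
    unfolding F_def by (rule UN_equiv_class[OF equiv_adapted_metric_equiv respects that])
  have "F \<in> (?D // ?R) \<rightarrow> (?W // ?E)"
    using F weight by (auto elim!: quotientE intro!: quotientI)
  moreover have "inj_on F (?D // ?R)"
  proof (rule inj_onI)
    fix C C' assume "C \<in> ?D // ?R" "C' \<in> ?D // ?R" and eq: "F C = F C'"
    then obtain d \<rho> where C: "d \<in> ?D" "C = ?R `` {d}" "\<rho> \<in> ?D" "C' = ?R `` {\<rho>}"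
      by (auto elim!: quotientE)
    then have "(d, \<rho>) \<in> ?R"
      using eq F f_eq_iff by simp
    then show "C = C'"
      using C equiv_class_eq[OF equiv_adapted_metric_equiv] by simp
  qed
  ultimately show ?thesis
    using iff F by blast
qed

end
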